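(* Let $G$ be a finite group and $H$, $K$ be any two subgroups of $G$. If $\Pr(H,K)=\frac{2p-1}{p^2}$ for some prime $p$, then $p$ divides $|G|$. If $p$ happens to be the smallest prime divisor of $|G|$, then $$\frac{H}{C_H(K)}\cong C_p\cong\frac{K}{C_K(H)},\quad\text{and hence, } H\ne K.$$ In particular, $\frac{H}{C_H(K)}\cong C_2\cong\frac{K}{C_K(H)}$ if $\Pr(H,K)=\frac34$.
   Context: $\Pr(H,K)=|\{(x,y)\in H\times K:xy=yx\}|/(|H||K|)$. $C_H(K)=\{h\in H:hk=kh\text{ for all }k\in K\}$ and $C_K(H)=\{k\in K:hk=kh\text{ for all }h\in H\}$. $C_p$ denotes the cyclic group of order $p$. *)

theory Defs
  imports Complex_Main "HOL-Algebra.Algebra" "HOL-Computational_Algebra.Primes"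
begin

definition relative_centralizer ::
  "('a, 'b) monoid_scheme \<Rightarrow> 'a set \<Rightarrow> 'a set \<Rightarrow> 'a set"
  where "relative_centralizer G H K =
    {h \<in> H. \<forall>k \<in> K. h \<otimes>\<^bsub>G\<^esub> k = k \<otimes>\<^bsub>G\<^esub> h}"

definition commuting_prob ::
  "('a, 'b) monoid_scheme \<Rightarrow> 'a set \<Rightarrow> 'a set \<Rightarrow> real"
  where "commuting_prob G H K =
    real (card {(x, y) \<in> H \<times> K. x \<otimes>\<^bsub>G\<^esub> y = y \<otimes>\<^bsub>G\<^esub> x}) / (real (card H) * real (card K))"

(* The set relative_centralizer G H K is a subgroup of H but need not be normal in H, and the
   library's Mod only denotes a group for a normal subgroup.  So "H / C_H(K) is (a group)
   isomorphic to Q" is the conjunction of normality and isomorphism. *)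
definition centralizer_quotient_iso ::
  "('a, 'b) monoid_scheme \<Rightarrow> 'a set \<Rightarrow> 'a set \<Rightarrow> ('c, 'd) monoid_scheme \<Rightarrow> bool"
  where "centralizer_quotient_iso G H K Q \<longleftrightarrow>
    relative_centralizer G H K \<lhd> G\<lparr>carrier := H\<rparr> \<and>
    G\<lparr>carrier := H\<rparr> Mod relative_centralizer G H K \<cong> Q"

end

theory Submission
  imports Defs
begin

text \<open>
  Write \<open>C\<close> for \<open>C\<^sub>H(K)\<close>. The number of commuting pairs is the sum of \<open>|C\<^sub>K(x)|\<close> over \<open>x \<in> H\<close>.
  Clearing denominators in the hypothesis says that \<open>p\<^sup>2\<close> times this number is
  \<open>(2p - 1) |H| |K|\<close>; since \<open>p\<close> is coprime to \<open>2p - 1\<close>, it divides \<open>|H|\<close> or \<open>|K|\<close>,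
  hence \<open>|G|\<close>.

  Now let \<open>p\<close> be the least prime divisor of \<open>|G|\<close>, so that every proper subgroup of a subgroup
  of \<open>G\<close> has index at least \<open>p\<close> in it. An element of \<open>C\<close> contributes \<open>|K|\<close> to the sum and
  every other element of \<open>H\<close> at most \<open>|K| / p\<close>. Comparing with the exact value of the sum
  bounds \<open>[H : C]\<close> above by \<open>p\<close>. As \<open>2p - 1 \<noteq> p\<^sup>2\<close>, \<open>C\<close> is a proper subgroup, so the index
  is exactly \<open>p\<close> (\<open>index_relative_centralizer\<close>).
  A subgroup whose index is a lower bound for the prime divisors of the group order is normal
  (\<open>normal_of_least_prime_index\<close>), so the quotient is a group of prime order and therefore cyclic.
  The commuting probability is symmetric in \<open>H\<close> and \<open>K\<close>, which gives the second isomorphism.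

  If \<open>H = K\<close>, then \<open>C\<close> is the centre of \<open>H\<close>, and it would have index \<open>p\<close> in \<open>H\<close>.
  For a noncentral \<open>h\<close> the chain \<open>Z(H) \<subset> C\<^sub>H(h) \<subset> H\<close> is strict, so that \<open>|C\<^sub>H(h)| \<ge> p |Z(H)| = |H|\<close>,
  a contradiction (\<open>card_neq_least_prime_times_centre\<close>).

  The value \<open>3/4\<close> is the case \<open>p = 2\<close>, and \<open>2\<close> is a lower bound for all primes.
\<close>

section \<open>Groups of prime order\<close>

lemma (in group) prime_order_iso_integer_mod_group:
  assumes p: "Factorial_Ring.prime p" and ord: "Coset.order G = p"
  shows "G \<cong> integer_mod_group p"
proof -
  have p1: "p > 1" using p by (rule prime_gt_1_nat)
  have fin: "finite (carrier G)"
    using ord p1 order_gt_0_iff_finite by simp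
  have "carrier G \<noteq> {\<one>}"
    using ord p1 by (auto simp: Coset.order_def)
  then obtain g where g: "g \<in> carrier G" "g \<noteq> \<one>"
    using one_closed by blast
  have ordg: "ord g = p"
    using ord_dvd_group_order[OF g(1)] g p ord ord_eq_1[OF g(1)]
    by (auto simp: prime_nat_iff)
  define f where "f = (\<lambda>i::int. g [^] i)"
  have hom: "f \<in> hom (integer_mod_group p) G"
  proof (rule homI)
    fix x y assume "x \<in> carrier (integer_mod_group p)" "y \<in> carrier (integer_mod_group p)"
    have "g [^] ((x + y) mod int p) = g [^] (x + y)"
      using int_pow_eq[OF g(1)] ordg by (simp add: mod_eq_dvd_iff[symmetric])
    then show "f (x \<otimes>\<^bsub>integer_mod_group p\<^esub> y) = f x \<otimes> f y"
      using g(1) by (simp add: f_def int_pow_mult)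
  qed (simp add: f_def g)
  have inj: "inj_on f (carrier (integer_mod_group p))"
  proof (rule inj_onI)
    fix x y assume "x \<in> carrier (integer_mod_group p)" "y \<in> carrier (integer_mod_group p)" "f x = f y"
    then have "x \<in> {0..<int p}" "y \<in> {0..<int p}" "int p dvd y - x"
      using p1 int_pow_eq[OF g(1)] ordg by (auto simp: f_def carrier_integer_mod_group)
    then show "x = y"
      by (metis atLeastLessThan_iff mod_eq_dvd_iff mod_pos_pos_trivial)
  qed
  have "f ` carrier (integer_mod_group p) \<subseteq> carrier G"
    using g by (auto simp: f_def)
  moreover have "card (f ` carrier (integer_mod_group p)) = card (carrier G)"
    using card_image[OF inj] ord p1 by (simp add: carrier_integer_mod_group Coset.order_def)
  ultimately have "f ` carrier (integer_mod_group p) = carrier G"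
    using fin by (simp add: card_subset_eq)
  then have "f \<in> iso (integer_mod_group p) G"
    using hom inj by (simp add: iso_def bij_betw_def)
  then have "integer_mod_group p \<cong> G"
    by (auto simp: is_iso_def)
  then show ?thesis
    using group.iso_sym[OF group_integer_mod_group] by blast
qed

section \<open>Subgroups whose index bounds the prime divisors from below\<close>

lemma (in group) card_subgroup_pos:
  assumes "finite (carrier G)" "subgroup H G"
  shows "card H > 0"
  using assms by (metis card_gt_0_iff empty_iff finite_subset subgroup.one_closed subgroup.subset)

text \<open>
  If \<open>j\<close> is coprime to the group order, then \<open>h\<close> is itself a power of \<open>h [^] j\<close>.
\<close>

lemma (in group) root_mem_subgroup:
  assumes N: "subgroup N G" and h: "h \<in> carrier G" and hj: "h [^] (j::nat) \<in> N"
    and cop: "coprime j (Coset.order G)" 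
  shows "h \<in> N"
proof -
  obtain u v where uv: "u * int j + v * int (Coset.order G) = 1"
    using cop bezout_int[of "int j" "int (Coset.order G)"] by (auto simp: coprime_iff_gcd_eq_1)
  have "h = h [^] (int j * u + int (Coset.order G) * v)"
    using uv h by (simp add: mult.commute)
  also have "\<dots> = (h [^] j) [^] u \<otimes> (h [^] Coset.order G) [^] v"
    using h by (simp add: int_pow_mult int_pow_pow flip: int_pow_int)
  also have "\<dots> = (h [^] j) [^] u"
    using h by (simp add: pow_order_eq_1)
  also have "\<dots> \<in> N"
    using N hj by (rule subgroup_int_pow_closed)
  finally show ?thesis .
qed

text \<open>
  For \<open>h\<close> outside \<open>N\<close>, the \<open>p\<close> cosets of \<open>1, h, \<dots>, h\<^sup>p\<^sup>-\<^sup>1\<close> are distinct: an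
  exponent strictly between \<open>0\<close> and \<open>p\<close> is coprime to the group order, so a coincidence would
  put \<open>h\<close> into \<open>N\<close>. Hence they are all the cosets. Nothing forces \<open>p\<close> itself to be prime here.
\<close>

lemma (in group) powers_are_coset_representatives:
  assumes fin: "finite (carrier G)" and N: "subgroup N G"
    and index: "Coset.order G = p * card N"
    and least: "\<And>q::nat. \<lbrakk>Factorial_Ring.prime q; q dvd Coset.order G\<rbrakk> \<Longrightarrow> p \<le> q"
    and h: "h \<in> carrier G" "h \<notin> N" and x: "x \<in> carrier G"
  obtains i :: nat and n where "n \<in> N" "x = n \<otimes> h [^] i"
proof -
  have N_sub: "N \<subseteq> carrier G" using N by (rule subgroup.subset)
  have cardN: "card N > 0"
    using fin N by (rule card_subgroup_pos)
  let ?c = "\<lambda>i::nat. N #> h [^] i"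
  have no_repeat: "i = j" if ij: "i \<le> j" "j < p" and eq: "?c i = ?c j" for i j
  proof (rule ccontr)
    assume "i \<noteq> j"
    with ij have d: "0 < j - i" "j - i < p" by auto
    have "h [^] j \<in> ?c i"
      using eq N h by (simp add: rcos_self)
    then obtain n where n: "n \<in> N" "h [^] j = n \<otimes> h [^] i"
      by (auto simp: r_coset_def)
    have "h [^] j = h [^] (j - i) \<otimes> h [^] i"
      using h ij by (simp add: nat_pow_mult)
    then have "h [^] (j - i) \<in> N"
      using n N_sub h by (metis nat_pow_closed r_cancel subsetD)
    moreover have "coprime (j - i) (Coset.order G)"
    proof (rule ccontr)
      assume "\<not> coprime (j - i) (Coset.order G)"
      then have "gcd (j - i) (Coset.order G) \<noteq> 1"
        by (simp add: coprime_iff_gcd_eq_1)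
      then obtain q where q: "Factorial_Ring.prime q" "q dvd gcd (j - i) (Coset.order G)"
        using prime_factor_nat by blast
      then have "p \<le> q" "q \<le> j - i"
        using least d by (auto intro: dvd_imp_le)
      with d show False by simp
    qed
    ultimately show False
      using root_mem_subgroup[OF N h(1)] h(2) by blast
  qed
  have inj: "inj_on ?c {..<p}"
  proof (rule inj_onI)
    fix i j assume "i \<in> {..<p}" "j \<in> {..<p}" "?c i = ?c j"
    then show "i = j"
      using no_repeat[of i j] no_repeat[of j i] by (cases i j rule: le_cases) auto
  qed
  have "card (rcosets N) * card N = p * card N"
    using lagrange[OF N] index by simp
  then have card_cosets: "card (rcosets N) = p"
    using cardN by simp
  have "?c ` {..<p} \<subseteq> rcosets N"
    using h by (auto simp: RCOSETS_def)
  moreover have "card (?c ` {..<p}) = card (rcosets N)"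
    using card_image[OF inj] card_cosets by simp
  moreover have "finite (rcosets N)"
    using fin by (auto simp: RCOSETS_def)
  ultimately have "?c ` {..<p} = rcosets N"
    by (simp add: card_subset_eq)
  moreover have "N #> x \<in> rcosets N"
    using x by (auto simp: RCOSETS_def)
  ultimately obtain i where "N #> x = ?c i" by blast
  then have "x \<in> ?c i"
    using rcos_self[OF x N] by simp
  then show ?thesis
    using that by (auto simp: r_coset_def)
qed

text \<open>
  If a conjugate \<open>h\<close> of \<open>n \<in> N\<close> by \<open>x\<close> were outside \<open>N\<close>, then \<open>x\<^sup>-\<^sup>1\<close> would lie in some coset
  \<open>N h\<^sup>i = N x n\<^sup>i x\<^sup>-\<^sup>1\<close>. Cancelling \<open>x\<^sup>-\<^sup>1\<close> gives \<open>x \<in> N\<close>, and then \<open>h \<in> N\<close> after all.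
\<close>

lemma (in group) normal_of_least_prime_index:
  assumes fin: "finite (carrier G)" and N: "subgroup N G"
    and index: "Coset.order G = p * card N"
    and least: "\<And>q::nat. \<lbrakk>Factorial_Ring.prime q; q dvd Coset.order G\<rbrakk> \<Longrightarrow> p \<le> q"
  shows "N \<lhd> G"
proof (rule normal_invI[OF N])
  fix x n assume x: "x \<in> carrier G" and n: "n \<in> N"
  have nG: "n \<in> carrier G" using N n by (rule subgroup.mem_carrier)
  let ?h = "x \<otimes> n \<otimes> inv x"
  show "?h \<in> N"
  proof (rule ccontr)
    assume h: "?h \<notin> N"
    have "inv x \<in> carrier G" "?h \<in> carrier G" using x nG by auto
    then obtain i :: nat and m where m: "m \<in> N" "inv x = m \<otimes> ?h [^] i"
      using powers_are_coset_representatives[OF fin N index least _ h] by metis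
    have mG: "m \<in> carrier G" using N m(1) by (rule subgroup.mem_carrier)
    have pow: "?h [^] i = x \<otimes> n [^] i \<otimes> inv x"
    proof (induction i)
      case (Suc i)
      have "inv x \<otimes> (x \<otimes> (n \<otimes> inv x)) = n \<otimes> inv x"
        using x nG by (simp flip: m_assoc)
      then show ?case
        using Suc x nG by (simp add: m_assoc)
    qed (use x in simp)
    have "(m \<otimes> x \<otimes> n [^] i) \<otimes> inv x = \<one> \<otimes> inv x"
      using m(2) pow x nG mG by (simp add: m_assoc)
    then have "m \<otimes> x \<otimes> n [^] i = \<one>"
      using x nG mG by (metis inv_closed m_closed nat_pow_closed one_closed r_cancel)
    moreover have ni: "n [^] i \<in> N"
      using subgroup_int_pow_closed[OF N n, of "int i"] by (simp add: int_pow_int)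
    ultimately have "inv (n [^] i) = m \<otimes> x"
      using x nG mG by (intro inv_equality) auto
    then have "m \<otimes> x \<in> N"
      using subgroup.m_inv_closed[OF N ni] by simp
    then have "inv m \<otimes> (m \<otimes> x) \<in> N"
      using subgroup.m_closed[OF N subgroup.m_inv_closed[OF N m(1)]] by blast
    then have xN: "x \<in> N"
      using x mG by (simp flip: m_assoc)
    then show False
      using h subgroup.m_closed[OF N subgroup.m_closed[OF N xN n] subgroup.m_inv_closed[OF N xN]]
      by blast
  qed
qed

lemma (in group) proper_subgroup_card_le:
  assumes fin: "finite (carrier G)" and A: "subgroup A G" and B: "subgroup B G"
    and AB: "A \<subset> B"
    and least: "\<And>q::nat. \<lbrakk>Factorial_Ring.prime q; q dvd Coset.order G\<rbrakk> \<Longrightarrow> p \<le> q"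
  shows "p * card A \<le> card B"
proof -
  interpret B: group "G\<lparr>carrier := B\<rparr>" using B by (rule subgroup_imp_group)
  have "subgroup A (G\<lparr>carrier := B\<rparr>)"
    using A B AB by (intro subgroup_incl) auto
  from B.lagrange[OF this] obtain m where m: "m * card A = card B"
    by (auto simp: Coset.order_def)
  have finB: "finite B" using B fin by (meson finite_subset subgroup.subset)
  have "m \<noteq> 1" using m psubset_card_mono[OF finB AB] by auto
  then obtain q where q: "Factorial_Ring.prime q" "q dvd m"
    using prime_factor_nat by blast
  have "card B dvd Coset.order G"
    using lagrange[OF B] by (metis dvd_triv_right)
  then have "q dvd Coset.order G"
    using q(2) m by (metis dvd_trans dvd_triv_left)
  then have "p \<le> q" using least q(1) by blast
  have "m > 0" using m finB AB by (metis card_gt_0_iff mult_0 not_psubset_empty gr0I)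
  then have "q \<le> m" using q(2) by (simp add: dvd_imp_le)
  with \<open>p \<le> q\<close> show ?thesis using m by (metis le_trans mult_le_mono1)
qed

section \<open>Counting commuting pairs\<close>

lemma (in group) subgroup_relative_centralizer:
  assumes H: "subgroup H G" and K: "K \<subseteq> carrier G"
  shows "subgroup (relative_centralizer G H K) G"
proof (rule subgroupI)
  have HG: "H \<subseteq> carrier G" using H by (rule subgroup.subset)
  show "relative_centralizer G H K \<subseteq> carrier G"
    using HG by (auto simp: relative_centralizer_def)
  have "\<one> \<in> relative_centralizer G H K"
    using subgroup.one_closed[OF H] K by (auto simp: relative_centralizer_def)
  then show "relative_centralizer G H K \<noteq> {}" by blast
next
  fix a assume a: "a \<in> relative_centralizer G H K"
  then have aH: "a \<in> H" and aG: "a \<in> carrier G"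
    using subgroup.subset[OF H] by (auto simp: relative_centralizer_def)
  have "inv a \<otimes> k = k \<otimes> inv a" if k: "k \<in> K" for k
  proof -
    have kG: "k \<in> carrier G" using k K by blast
    have "a \<otimes> k = k \<otimes> a" using a k by (simp add: relative_centralizer_def)
    then have "inv a \<otimes> (a \<otimes> k) \<otimes> inv a = inv a \<otimes> (k \<otimes> a) \<otimes> inv a"
      by simp
    moreover have "inv a \<otimes> (a \<otimes> k) = k"
      using aG kG by (simp flip: m_assoc)
    ultimately show ?thesis
      using aG kG by (simp add: m_assoc)
  qed
  then show "inv a \<in> relative_centralizer G H K"
    using subgroup.m_inv_closed[OF H aH] by (simp add: relative_centralizer_def)
next
  fix a b assume a: "a \<in> relative_centralizer G H K" and b: "b \<in> relative_centralizer G H K"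
  then have abH: "a \<in> H" "b \<in> H" and abG: "a \<in> carrier G" "b \<in> carrier G"
    using subgroup.subset[OF H] by (auto simp: relative_centralizer_def)
  have "(a \<otimes> b) \<otimes> k = k \<otimes> (a \<otimes> b)" if k: "k \<in> K" for k
  proof -
    have kG: "k \<in> carrier G" using k K by blast
    have "a \<otimes> k = k \<otimes> a" "b \<otimes> k = k \<otimes> b"
      using a b k by (simp_all add: relative_centralizer_def)
    then show ?thesis
      using abG kG by (metis m_assoc)
  qed
  then show "a \<otimes> b \<in> relative_centralizer G H K"
    using subgroup.m_closed[OF H abH] by (simp add: relative_centralizer_def)
qed

lemma relative_centralizer_singleton_psubset:
  assumes "x \<in> H" "x \<notin> relative_centralizer G H K"
  shows "relative_centralizer G K {x} \<subset> K"
proof -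
  obtain k where "k \<in> K" "x \<otimes>\<^bsub>G\<^esub> k \<noteq> k \<otimes>\<^bsub>G\<^esub> x"
    using assms by (auto simp: relative_centralizer_def)
  then have "k \<in> K - relative_centralizer G K {x}"
    by (auto simp: relative_centralizer_def)
  moreover have "relative_centralizer G K {x} \<subseteq> K"
    by (auto simp: relative_centralizer_def)
  ultimately show ?thesis by blast
qed

lemma commuting_pairs_eq_sum_centralizers:
  assumes "finite H" "finite K"
  shows "card {(x, y) \<in> H \<times> K. x \<otimes>\<^bsub>G\<^esub> y = y \<otimes>\<^bsub>G\<^esub> x}
    = (\<Sum>x\<in>H. card (relative_centralizer G K {x}))"
proof -
  have "{(x, y) \<in> H \<times> K. x \<otimes>\<^bsub>G\<^esub> y = y \<otimes>\<^bsub>G\<^esub> x}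
      = (SIGMA x:H. relative_centralizer G K {x})"
    by (auto simp: relative_centralizer_def)
  moreover have "finite (relative_centralizer G K {x})" for x
    using assms by (simp add: relative_centralizer_def)
  ultimately show ?thesis
    using assms by (simp add: card_SigmaI)
qed

lemma commuting_prob_commute: "commuting_prob G H K = commuting_prob G K H"
proof -
  have "{(x, y) \<in> K \<times> H. x \<otimes>\<^bsub>G\<^esub> y = y \<otimes>\<^bsub>G\<^esub> x}
      = prod.swap ` {(x, y) \<in> H \<times> K. x \<otimes>\<^bsub>G\<^esub> y = y \<otimes>\<^bsub>G\<^esub> x}"
    by (auto simp: image_iff)
  then have "card {(x, y) \<in> K \<times> H. x \<otimes>\<^bsub>G\<^esub> y = y \<otimes>\<^bsub>G\<^esub> x}
      = card {(x, y) \<in> H \<times> K. x \<otimes>\<^bsub>G\<^esub> y = y \<otimes>\<^bsub>G\<^esub> x}"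
    by (simp add: card_image)
  then show ?thesis
    by (simp add: commuting_prob_def mult.commute)
qed

lemma (in group) commuting_prob_numerator:
  assumes fin: "finite (carrier G)" and H: "subgroup H G" and K: "subgroup K G"
    and p: "Factorial_Ring.prime p"
    and prob: "commuting_prob G H K = (2 * real p - 1) / (real p)\<^sup>2"
  shows "p * p * card {(x, y) \<in> H \<times> K. x \<otimes> y = y \<otimes> x} = (2 * p - 1) * (card H * card K)"
proof -
  have p1: "p > 1" using p by (rule prime_gt_1_nat)
  have "real (card H) * real (card K) \<noteq> 0" "(real p)\<^sup>2 \<noteq> 0"
    using card_subgroup_pos[OF fin H] card_subgroup_pos[OF fin K] p1 by auto
  then have "(real p)\<^sup>2 * real (card {(x, y) \<in> H \<times> K. x \<otimes> y = y \<otimes> x})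
      = (2 * real p - 1) * (real (card H) * real (card K))"
    using prob unfolding commuting_prob_def
    by (simp only: frac_eq_eq if_True if_False simp_thms) (simp only: ac_simps)
  moreover have "2 * real p - 1 = real (2 * p - 1)"
    using p1 by simp
  ultimately have "real (p * p * card {(x, y) \<in> H \<times> K. x \<otimes> y = y \<otimes> x})
      = real ((2 * p - 1) * (card H * card K))"
    by (simp add: power2_eq_square del: of_nat_diff)
  then show ?thesis
    by (simp only: of_nat_eq_iff)
qed

lemma (in group) prime_dvd_order_of_commuting_prob:
  assumes fin: "finite (carrier G)" and H: "subgroup H G" and K: "subgroup K G"
    and p: "Factorial_Ring.prime p"
    and prob: "commuting_prob G H K = (2 * real p - 1) / (real p)\<^sup>2"
  shows "p dvd Coset.order G"
proof -
  have p1: "p > 1" using p by (rule prime_gt_1_nat)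
  have "p dvd (2 * p - 1) * (card H * card K)"
    unfolding commuting_prob_numerator[OF assms, symmetric] by simp
  moreover have "\<not> p dvd 2 * p - 1"
  proof
    assume "p dvd 2 * p - 1"
    then have "p dvd 2 * p - (2 * p - 1)"
      using dvd_diff_nat[of p "2 * p" "2 * p - 1"] by simp
    then show False using p1 by simp
  qed
  ultimately have "p dvd card H \<or> p dvd card K"
    using p by (simp add: prime_dvd_mult_iff)
  then show ?thesis
    using lagrange[OF H] lagrange[OF K] by (metis dvd_mult)
qed

text \<open>
  The value \<open>(2p - 1)/p\<^sup>2\<close> is what \<open>[H : C\<^sub>H(K)] = p\<close> gives when \<open>[K : C\<^sub>K(x)] = p\<close> for every \<open>x\<close> outside
  \<open>C\<^sub>H(K)\<close>. If the index of \<open>C\<^sub>H(K)\<close> exceeds \<open>p\<close>, the probability is below this value.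
\<close>

lemma (in group) index_relative_centralizer:
  assumes fin: "finite (carrier G)" and H: "subgroup H G" and K: "subgroup K G"
    and p: "Factorial_Ring.prime p"
    and prob: "commuting_prob G H K = (2 * real p - 1) / (real p)\<^sup>2"
    and least: "\<And>q::nat. \<lbrakk>Factorial_Ring.prime q; q dvd Coset.order G\<rbrakk> \<Longrightarrow> p \<le> q"
  shows "card H = p * card (relative_centralizer G H K)"
proof -
  let ?C = "relative_centralizer G H K"
  let ?n = "\<lambda>x. card (relative_centralizer G K {x})"
  have p1: "p > 1" using p by (rule prime_gt_1_nat)
  have HG: "H \<subseteq> carrier G" and KG: "K \<subseteq> carrier G"
    using H K by (auto dest: subgroup.subset)
  have finH: "finite H" and finK: "finite K"
    using HG KG fin by (auto intro: finite_subset)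
  have CH: "?C \<subseteq> H" by (auto simp: relative_centralizer_def)
  have subC: "subgroup ?C G" using H KG by (rule subgroup_relative_centralizer)
  have posH: "card H > 0" and posK: "card K > 0"
    using card_subgroup_pos[OF fin] H K by auto
  have sum: "p * p * (\<Sum>x\<in>H. ?n x) = (2 * p - 1) * (card H * card K)"
    using commuting_prob_numerator[OF fin H K p prob]
      commuting_pairs_eq_sum_centralizers[OF finH finK, of G] by simp
  \<comment> \<open>Elements of the centralizer contribute \<open>|K|\<close> to the sum, all others at most \<open>|K| / p\<close>.\<close>
  have n_in: "?n x = card K" if "x \<in> ?C" for x
  proof -
    have "relative_centralizer G K {x} = K"
      using that by (auto simp: relative_centralizer_def)
    then show ?thesis by simp
  qed
  have n_out: "p * ?n x \<le> card K" if "x \<in> H - ?C" for x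
  proof (rule proper_subgroup_card_le[OF fin _ K _ least])
    show "subgroup (relative_centralizer G K {x}) G"
      using that HG by (intro subgroup_relative_centralizer[OF K]) auto
    show "relative_centralizer G K {x} \<subset> K"
      using that by (intro relative_centralizer_singleton_psubset) auto
  qed
  have split: "(\<Sum>x\<in>H. ?n x) = (\<Sum>x\<in>?C. ?n x) + (\<Sum>x\<in>H - ?C. ?n x)"
    using sum.subset_diff[OF CH finH] by (simp add: add.commute)
  \<comment> \<open>Otherwise all pairs commute, and \<open>(p - 1)\<^sup>2 = 0\<close>.\<close>
  have ne: "?C \<noteq> H"
  proof
    assume "?C = H"
    then have "p * p * (card H * card K) = (2 * p - 1) * (card H * card K)"
      using sum n_in by simp
    then have "p * p = 2 * p - 1" using posH posK by simp
    moreover obtain k where "p = Suc k" "k > 0" using p1 by (cases p) auto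
    ultimately show False by simp
  qed
  have ge: "p * card ?C \<le> card H"
    using CH ne by (intro proper_subgroup_card_le[OF fin subC H _ least]) auto
  have "p * (\<Sum>x\<in>H. ?n x) = p * (card ?C * card K) + (\<Sum>x\<in>H - ?C. p * ?n x)"
    using split n_in by (simp add: sum_distrib_left distrib_left)
  also have "\<dots> \<le> p * (card ?C * card K) + (card H - card ?C) * card K"
    using sum_mono[of "H - ?C" "\<lambda>x. p * ?n x" "\<lambda>_. card K"] n_out CH finH
    by (simp add: card_Diff_subset finite_subset)
  finally have "p * (\<Sum>x\<in>H. ?n x) \<le> (p * card ?C + (card H - card ?C)) * card K"
    by (simp only: distrib_right mult.assoc)
  then have "p * (p * (\<Sum>x\<in>H. ?n x)) \<le> p * ((p * card ?C + (card H - card ?C)) * card K)"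
    by (rule mult_le_mono2)
  then have "((2 * p - 1) * card H) * card K \<le> (p * (p * card ?C + (card H - card ?C))) * card K"
    using sum by (simp only: mult.assoc)
  then have "(2 * p - 1) * card H \<le> p * (p * card ?C + (card H - card ?C))"
    using posK by simp
  \<comment> \<open>Substituting \<open>|H| = |C| + d\<close> and \<open>p = k + 1\<close> removes the truncated subtractions.\<close>
  moreover obtain d where d: "card H = card ?C + d" using card_mono[OF finH CH] le_Suc_ex by blast
  moreover obtain k where k: "p = Suc k" "k > 0" using p1 by (cases p) auto
  ultimately have "k * d \<le> k * (k * card ?C)"
    by (simp add: algebra_simps)
  then have "card H \<le> p * card ?C"
    using k d by simp
  with ge show ?thesis by simp
qed

section \<open>The quotient by the centralizer\<close>

lemma (in group) centralizer_quotient_iso_prime: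
  assumes fin: "finite (carrier G)" and H: "subgroup H G" and K: "subgroup K G"
    and p: "Factorial_Ring.prime p"
    and prob: "commuting_prob G H K = (2 * real p - 1) / (real p)\<^sup>2"
    and least: "\<And>q::nat. \<lbrakk>Factorial_Ring.prime q; q dvd Coset.order G\<rbrakk> \<Longrightarrow> p \<le> q"
  shows "centralizer_quotient_iso G H K (integer_mod_group p)"
proof -
  let ?C = "relative_centralizer G H K"
  let ?H = "G\<lparr>carrier := H\<rparr>"
  interpret H: group ?H using H by (rule subgroup_imp_group)
  have subC: "subgroup ?C G"
    using H subgroup.subset[OF K] by (rule subgroup_relative_centralizer)
  then have subC': "subgroup ?C ?H"
    using H by (intro subgroup_incl) (auto simp: relative_centralizer_def)
  have index: "Coset.order ?H = p * card ?C"
    using index_relative_centralizer[OF assms] by (simp add: Coset.order_def)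
  have "card H dvd Coset.order G"
    using lagrange[OF H] by (metis dvd_triv_right)
  then have "p \<le> q" if "Factorial_Ring.prime q" "q dvd Coset.order ?H" for q
    using least that by (auto simp: Coset.order_def)
  moreover have "finite (carrier ?H)"
    using fin subgroup.subset[OF H] by (auto intro: finite_subset)
  ultimately have normal: "?C \<lhd> ?H"
    using H.normal_of_least_prime_index[OF _ subC' index] by blast
  have "Coset.order (?H Mod ?C) = card (rcosets\<^bsub>?H\<^esub> ?C)"
    by (simp add: Coset.order_def FactGroup_def)
  also have "\<dots> = p"
    using H.lagrange[OF subC'] index card_subgroup_pos[OF fin subC] by simp
  finally have "?H Mod ?C \<cong> integer_mod_group p"
    by (rule group.prime_order_iso_integer_mod_group[OF normal.factorgroup_is_group[OF normal] p])
  with normal show ?thesis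
    by (simp add: centralizer_quotient_iso_def)
qed

text \<open>
  The set \<open>relative_centralizer G H H\<close> is the centre of \<open>H\<close>.
\<close>

lemma (in group) card_neq_least_prime_times_centre:
  assumes fin: "finite (carrier G)" and H: "subgroup H G"
    and p: "Factorial_Ring.prime p"
    and least: "\<And>q::nat. \<lbrakk>Factorial_Ring.prime q; q dvd Coset.order G\<rbrakk> \<Longrightarrow> p \<le> q"
  shows "card H \<noteq> p * card (relative_centralizer G H H)"
proof
  let ?C = "relative_centralizer G H H"
  assume index: "card H = p * card ?C"
  have p1: "p > 1" using p by (rule prime_gt_1_nat)
  have HG: "H \<subseteq> carrier G" using H by (rule subgroup.subset)
  have CH: "?C \<subseteq> H" by (auto simp: relative_centralizer_def)
  have subC: "subgroup ?C G" using H HG by (rule subgroup_relative_centralizer)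
  have finH: "finite H" using HG fin by (rule finite_subset)
  have "?C \<noteq> H" using index card_subgroup_pos[OF fin H] p1 by auto
  then obtain h where h: "h \<in> H" "h \<notin> ?C" using CH by blast
  let ?D = "relative_centralizer G H {h}"
  have subD: "subgroup ?D G" using h HG by (intro subgroup_relative_centralizer[OF H]) auto
  have "h \<in> ?D" using h by (simp add: relative_centralizer_def)
  moreover have "?C \<subseteq> ?D" using h by (auto simp: relative_centralizer_def)
  ultimately have CD: "?C \<subset> ?D" using h by blast
  have DH: "?D \<subset> H" using h by (rule relative_centralizer_singleton_psubset)
  have "p * card ?C \<le> card ?D"
    by (rule proper_subgroup_card_le[OF fin subC subD CD least])
  moreover have "card ?D < card H" using finH DH by (rule psubset_card_mono)
  ultimately show False using index by simp
qed

theorem proposition5p2p10: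
  fixes G :: "('a, 'b) monoid_scheme" and H K :: "'a set"
  assumes "group G" and "finite (carrier G)"
    and "subgroup H G" and "subgroup K G"
  shows "(\<forall>p::nat. Factorial_Ring.prime p \<and> commuting_prob G H K = (2 * real p - 1) / (real p)\<^sup>2 \<longrightarrow>
            p dvd Coset.order G \<and>
            ((\<forall>q::nat. Factorial_Ring.prime q \<and> q dvd Coset.order G \<longrightarrow> p \<le> q) \<longrightarrow>
               centralizer_quotient_iso G H K (integer_mod_group p) \<and>
               centralizer_quotient_iso G K H (integer_mod_group p) \<and>
               H \<noteq> K)) \<and>
         (commuting_prob G H K = 3 / 4 \<longrightarrow>
            centralizer_quotient_iso G H K (integer_mod_group 2) \<and>
            centralizer_quotient_iso G K H (integer_mod_group 2))"
proof -
  interpret group G by fact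
  have iso: "centralizer_quotient_iso G H K (integer_mod_group p) \<and>
      centralizer_quotient_iso G K H (integer_mod_group p)"
    if "Factorial_Ring.prime p" "commuting_prob G H K = (2 * real p - 1) / (real p)\<^sup>2"
      "\<And>q::nat. \<lbrakk>Factorial_Ring.prime q; q dvd Coset.order G\<rbrakk> \<Longrightarrow> p \<le> q" for p
    using centralizer_quotient_iso_prime[OF assms(2,3,4) that]
      centralizer_quotient_iso_prime[OF assms(2,4,3) that(1) _ that(3)]
      commuting_prob_commute[of G H K] that(2) by simp
  have distinct: "H \<noteq> K"
    if "Factorial_Ring.prime p" "commuting_prob G H K = (2 * real p - 1) / (real p)\<^sup>2"
      "\<And>q::nat. \<lbrakk>Factorial_Ring.prime q; q dvd Coset.order G\<rbrakk> \<Longrightarrow> p \<le> q" for p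
    using index_relative_centralizer[OF assms(2,3,4) that]
      card_neq_least_prime_times_centre[OF assms(2,3) that(1) that(3)] by blast
  have two: "centralizer_quotient_iso G H K (integer_mod_group 2) \<and>
      centralizer_quotient_iso G K H (integer_mod_group 2)"
    if "commuting_prob G H K = 3 / 4"
    using that by (intro iso) (simp_all add: prime_ge_2_nat)
  show ?thesis
    using iso distinct two prime_dvd_order_of_commuting_prob[OF assms(2,3,4)] by blast
qed

end
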